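(* Let $I\subset\mathbb{R}$ be an open interval, $x:I\to\mathbb{C}$ a smooth arc-length parametrized curve with nowhere vanishing curvature, $J\ni0$ an open interval, and let $\mathbf S:J\to(0,\infty)$, $\mathbf R:J\to\mathbb{R}$, $\mathbf T:J\to\mathbb{C}$ be smooth with $\mathbf S(0)=1$, $\mathbf R(0)=0$, $\mathbf T(0)=0$. Suppose that the family $x(s,t)=\mathbf S(t)e^{i\mathbf R(t)}x(s)+\mathbf T(t)$ is a solution of the inverse mean curvature flow, and that the rotation part or the scaling part is nonzero, i.e. $\mathbf R\not\equiv0$ or $\mathbf S\not\equiv1$. Then one can choose a new origin $p\in\mathbb{C}$ such that, in the coordinate $z-p$, the solution moves only by rotation and scaling: there are smooth functions $\tilde{\mathbf S}:J\to(0,\infty)$ and $\tilde{\mathbf R}:J\to\mathbb{R}$ with $\tilde{\mathbf S}(0)=1$, $\tilde{\mathbf R}(0)=0$, such that the families $x(s,t)$ and $p+\tilde{\mathbf S}(t)e^{i\tilde{\mathbf R}(t)}(x(s)-p)$ coincide up to tangential reparametrization.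
   Context: $\mathbb{R}^2$ is identified with $\mathbb{C}$ and $\langle z,w\rangle=\mathrm{Re}(z\bar w)$. For an arc-length parametrized curve $x(s)$, $T=dx/ds$, $N=iT$, and the signed curvature is $k=\langle dT/ds,N\rangle$. A family of curves $x(s,t)$ is a solution of the inverse mean curvature flow if $\langle \partial_t x(s,t),N(s,t)\rangle=-1/k(s,t)$, where $N(s,t)$ and $k(s,t)$ are the unit normal and signed curvature of $x(\cdot,t)$; for the family above, $N(s,t)=e^{i\mathbf R(t)}N(s)$ and $k(s,t)=k(s)/\mathbf S(t)$. Since the flow prescribes only the normal velocity, solutions are identified up to tangential reparametrization: two families $X,Y:I\times J\to\mathbb{C}$ with $X(\cdot,0)=Y(\cdot,0)$ coincide up to tangential reparametrization if for every $s_0\in I$ there are $\varepsilon>0$ and a smooth function $\varphi(s,t)\in I$, defined for $|s-s_0|<\varepsilon$, $|t|<\varepsilon$, with $\varphi(s,0)=s$ and $Y(s,t)=X(\varphi(s,t),t)$; if $I=\mathbb{R}$, $\varphi$ is required to be defined on all of $\mathbb{R}\times J$ with each $\varphi(\cdot,t)$ a diffeomorphism of $\mathbb{R}$. *)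

theory Defs
  imports "HOL-Analysis.Analysis"
begin

text \<open>Differentiability of order \<open>n\<close> and smoothness; intended for open sets \<open>A\<close>, since all
  derivatives are taken with respect to the full filter \<open>at x\<close>.\<close>

primrec Ck_on :: "nat \<Rightarrow> ('a::real_normed_vector \<Rightarrow> 'b::real_normed_vector) \<Rightarrow> 'a set \<Rightarrow> bool" where
  "Ck_on 0 f A \<longleftrightarrow> continuous_on A f"
| "Ck_on (Suc n) f A \<longleftrightarrow>
     (\<forall>x\<in>A. f differentiable (at x)) \<and>
     (\<forall>v. Ck_on n (\<lambda>x. frechet_derivative f (at x) v) A)"

definition smooth_on :: "('a::real_normed_vector \<Rightarrow> 'b::real_normed_vector) \<Rightarrow> 'a set \<Rightarrow> bool" where
  "smooth_on f A \<longleftrightarrow> (\<forall>n. Ck_on n f A)"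

definition diffeo_real :: "(real \<Rightarrow> real) \<Rightarrow> bool" where
  "diffeo_real f \<longleftrightarrow> bij f \<and> smooth_on f UNIV \<and> smooth_on (inv f) UNIV"

definition arc_length_on :: "(real \<Rightarrow> complex) \<Rightarrow> real set \<Rightarrow> bool" where
  "arc_length_on \<gamma> I \<longleftrightarrow> (\<forall>u\<in>I. norm (vector_derivative \<gamma> (at u)) = 1)"

text \<open>The members \<open>X(\<cdot>, t)\<close> of a family need not be parametrized by arc length, so tangent, normal
  and curvature are defined for regular curves, the arc-length derivative \<open>d/ds\<close> being
  \<open>\<bar>\<gamma>'(u)\<bar>\<^sup>-\<^sup>1 d/du\<close>. The inner product \<open>z \<bullet> w\<close> on the type of complex numbers is
  the real part of \<open>z * cnj w\<close>.\<close>

definition unit_tangent :: "(real \<Rightarrow> complex) \<Rightarrow> real \<Rightarrow> complex" where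
  "unit_tangent \<gamma> u = vector_derivative \<gamma> (at u) /\<^sub>R norm (vector_derivative \<gamma> (at u))"

definition unit_normal :: "(real \<Rightarrow> complex) \<Rightarrow> real \<Rightarrow> complex" where
  "unit_normal \<gamma> u = \<i> * unit_tangent \<gamma> u"

definition signed_curvature :: "(real \<Rightarrow> complex) \<Rightarrow> real \<Rightarrow> real" where
  "signed_curvature \<gamma> u =
     (vector_derivative (unit_tangent \<gamma>) (at u) /\<^sub>R norm (vector_derivative \<gamma> (at u)))
       \<bullet> unit_normal \<gamma> u"

text \<open>Families are curried: \<open>X s t\<close> is the point with curve parameter \<open>s\<close> at time \<open>t\<close>.
  The requirement that the curvature is nonzero makes the right-hand side \<open>-1/k\<close> meaningful
  and, because \<open>unit_normal\<close> is zero where the derivative vanishes, also enforces regularity.\<close>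

definition imcf_solution :: "real set \<Rightarrow> real set \<Rightarrow> (real \<Rightarrow> real \<Rightarrow> complex) \<Rightarrow> bool" where
  "imcf_solution I J X \<longleftrightarrow>
     (\<forall>s\<in>I. \<forall>t\<in>J.
        signed_curvature (\<lambda>u. X u t) s \<noteq> 0 \<and>
        vector_derivative (\<lambda>\<tau>. X s \<tau>) (at t) \<bullet> unit_normal (\<lambda>u. X u t) s
          = - 1 / signed_curvature (\<lambda>u. X u t) s)"

text \<open>In the local clause, \<open>\<phi> (s, 0) = s \<in> I\<close> forces \<open>{s0 - \<epsilon><..<s0 + \<epsilon>} \<subseteq> I\<close>, so \<open>Y s t\<close> is
  evaluated only at points of its domain \<open>I \<times> J\<close>.\<close>

definition coincide_up_to_reparam ::
  "real set \<Rightarrow> real set \<Rightarrow> (real \<Rightarrow> real \<Rightarrow> complex) \<Rightarrow> (real \<Rightarrow> real \<Rightarrow> complex) \<Rightarrow> bool" where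
  "coincide_up_to_reparam I J X Y \<longleftrightarrow>
     (\<forall>s\<in>I. X s 0 = Y s 0) \<and>
     (if I = UNIV then
        (\<exists>\<phi> :: real \<times> real \<Rightarrow> real.
           smooth_on \<phi> (UNIV \<times> J) \<and>
           (\<forall>s. \<phi> (s, 0) = s) \<and>
           (\<forall>t\<in>J. diffeo_real (\<lambda>s. \<phi> (s, t))) \<and>
           (\<forall>s. \<forall>t\<in>J. Y s t = X (\<phi> (s, t)) t))
      else
        (\<forall>s0\<in>I. \<exists>\<epsilon>>0. \<exists>\<phi> :: real \<times> real \<Rightarrow> real.
           {- \<epsilon><..<\<epsilon>} \<subseteq> J \<and>
           smooth_on \<phi> ({s0 - \<epsilon><..<s0 + \<epsilon>} \<times> {- \<epsilon><..<\<epsilon>}) \<and>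
           (\<forall>s\<in>{s0 - \<epsilon><..<s0 + \<epsilon>}. \<phi> (s, 0) = s) \<and>
           (\<forall>s\<in>{s0 - \<epsilon><..<s0 + \<epsilon>}. \<forall>t\<in>{- \<epsilon><..<\<epsilon>}.
              \<phi> (s, t) \<in> I \<and> Y s t = X (\<phi> (s, t)) t)))"

end

theory Submission
  imports Defs
begin

text \<open>Write the motion as \<open>z \<mapsto> w(t) z + T(t)\<close> with \<open>w = S e^(iR)\<close>, and put \<open>a = w'/w\<close>,
  \<open>b = T'/w\<close>. Curvature and normal scale and rotate with \<open>w\<close>, so the flow equation at time \<open>t\<close>
  can be pulled back to the fixed curve \<open>x\<close>: it says that the vector field \<open>z \<mapsto> a(t) z + b(t)\<close>
  has normal component \<open>-1/k\<close> along \<open>x\<close> (\<open>imcf_similarity\<close>). The right-hand side does not depend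
  on \<open>t\<close>, which leaves two possibilities (\<open>common_centre\<close>).

  If \<open>(a, b)\<close> is constant in time, then \<open>a\<close> is not zero, because otherwise \<open>w\<close> would be constant
  and there would be neither rotation nor scaling;
  hence \<open>b = - a p\<close> for \<open>p = - b / a\<close>.

  Otherwise the difference of two of these fields is a nonzero field \<open>z \<mapsto> c z + d\<close> tangent to
  \<open>x\<close>. As \<open>x\<close> is curved, \<open>c\<close> cannot be real (\<open>tangential_field_not_real\<close>), and \<open>x\<close> is an arc of a
  logarithmic spiral or a circle about \<open>p = - d / c\<close>. Along such an arc both \<open>1/k\<close> and the normal
  component of \<open>a(t) (z - p)\<close> are constant multiples of the distance to \<open>p\<close>. The constant part
  \<open>b(t) + a(t) p\<close> of the field would therefore have a normal component proportional to that distance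
  too. In terms of the tangent angle \<open>\<psi>\<close>, this equates a sinusoid with a real exponential
  \<open>C e^(\<kappa>\<psi>)\<close>, so it must vanish, and \<open>b = - a p\<close> again (\<open>spiral_centre_is_fixed\<close>).

  In both cases \<open>T' = - p w'\<close>, whence \<open>T = p - w p\<close>. The family is then literally
  \<open>p + w(t) (x(s) - p)\<close>: the same \<open>S\<close> and \<open>R\<close> serve, and the reparametrization is the identity.\<close>

section \<open>Smooth functions\<close>

lemma smooth_on_has_vector_derivative:
  assumes "smooth_on f A" "s \<in> A"
  shows "(f has_vector_derivative vector_derivative f (at s)) (at s)"
proof -
  have "Ck_on (Suc 0) f A" using assms(1) unfolding smooth_on_def by blast
  then show ?thesis using assms(2) by (simp add: vector_derivative_works[symmetric])
qed

lemma smooth_on_has_second_vector_derivative: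
  fixes f :: "real \<Rightarrow> 'b::real_normed_vector"
  assumes "smooth_on f A" "open A" "s \<in> A"
  shows "\<exists>D. ((\<lambda>u. vector_derivative f (at u)) has_vector_derivative D) (at s)"
proof -
  have C: "Ck_on (Suc (Suc 0)) f A" using assms(1) unfolding smooth_on_def by blast
  have eq: "frechet_derivative f (at u) 1 = vector_derivative f (at u)" if "u \<in> A" for u
    using C that by (simp add: frechet_derivative_eq_vector_derivative)
  have "(\<lambda>u. frechet_derivative f (at u) 1) differentiable (at s)"
    using C assms(3) by simp
  then obtain D where "((\<lambda>u. frechet_derivative f (at u) 1) has_vector_derivative D) (at s)"
    using vector_derivative_works by blast
  then have "((\<lambda>u. vector_derivative f (at u)) has_vector_derivative D) (at s)"
    by (rule has_vector_derivative_transform_within_open[OF _ assms(2,3)]) (rule eq)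
  then show ?thesis ..
qed

lemma smooth_on_const: "smooth_on (\<lambda>_. c) A"
proof -
  have "Ck_on n (\<lambda>_. c) A" for n and c :: 'b
    by (induction n arbitrary: c) (simp_all add: frechet_derivative_const)
  then show ?thesis unfolding smooth_on_def by blast
qed

lemma smooth_on_bounded_linear:
  assumes "bounded_linear f"
  shows "smooth_on f A"
proof -
  have D: "frechet_derivative f (at u) = f" for u
    using bounded_linear_imp_has_derivative[OF assms] frechet_derivative_at by metis
  have "Ck_on n f A" for n
  proof (cases n)
    case 0
    then show ?thesis using assms by (simp add: linear_continuous_on)
  next
    case (Suc m)
    then show ?thesis
      using smooth_on_const assms
      by (auto simp: D smooth_on_def bounded_linear_imp_differentiable)
  qed
  then show ?thesis unfolding smooth_on_def by blast
qed

text \<open>The reparametrization is \<open>\<phi>(s, t) = s\<close>, which is smooth because it is linear.\<close>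

lemma coincide_up_to_reparam_refl:
  assumes "open I" "open J" "0 \<in> J" "\<And>s t. s \<in> I \<Longrightarrow> t \<in> J \<Longrightarrow> X s t = Y s t"
  shows "coincide_up_to_reparam I J X Y"
proof -
  have fst: "smooth_on fst A" for A :: "(real \<times> real) set"
    by (rule smooth_on_bounded_linear) (rule bounded_linear_fst)
  have id: "diffeo_real (\<lambda>s. s)"
    unfolding diffeo_real_def using smooth_on_bounded_linear[OF bounded_linear_ident, of UNIV]
    by (auto simp: bij_id[unfolded id_def] inv_id[unfolded id_def])
  show ?thesis
  proof (cases "I = UNIV")
    case True
    then show ?thesis unfolding coincide_up_to_reparam_def
      using assms fst id by (auto intro!: exI[of _ fst])
  next
    case False
    have nbhd: "\<exists>\<epsilon>>0. {- \<epsilon><..<\<epsilon>} \<subseteq> J \<and> {s0 - \<epsilon><..<s0 + \<epsilon>} \<subseteq> I" if s0: "s0 \<in> I" for s0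
    proof -
      obtain e where e: "e > 0" "ball s0 e \<subseteq> I"
        using assms(1) s0 open_contains_ball by blast
      obtain d where d: "d > 0" "ball 0 d \<subseteq> J"
        using assms(2,3) open_contains_ball by blast
      have "{- min d e<..<min d e} \<subseteq> ball 0 d" "{s0 - min d e<..<s0 + min d e} \<subseteq> ball s0 e"
        by (auto simp: dist_real_def)
      then show ?thesis using e d by (intro exI[of _ "min d e"]) auto
    qed
    have "\<exists>\<epsilon>>0. \<exists>\<phi> :: real \<times> real \<Rightarrow> real. {- \<epsilon><..<\<epsilon>} \<subseteq> J \<and>
           smooth_on \<phi> ({s0 - \<epsilon><..<s0 + \<epsilon>} \<times> {- \<epsilon><..<\<epsilon>}) \<and>
           (\<forall>s\<in>{s0 - \<epsilon><..<s0 + \<epsilon>}. \<phi> (s, 0) = s) \<and>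
           (\<forall>s\<in>{s0 - \<epsilon><..<s0 + \<epsilon>}. \<forall>t\<in>{- \<epsilon><..<\<epsilon>}.
              \<phi> (s, t) \<in> I \<and> Y s t = X (\<phi> (s, t)) t)" if s0: "s0 \<in> I" for s0
    proof -
      obtain \<epsilon> where "\<epsilon> > 0" "{- \<epsilon><..<\<epsilon>} \<subseteq> J" "{s0 - \<epsilon><..<s0 + \<epsilon>} \<subseteq> I"
        using nbhd[OF s0] by blast
      then show ?thesis
        using fst assms(4) by (intro exI[of _ \<epsilon>] conjI exI[of _ fst]) (auto simp: subset_iff)
    qed
    then show ?thesis unfolding coincide_up_to_reparam_def using False assms(3,4) by auto
  qed
qed

section \<open>Normal and curvature under similarities\<close>

text \<open>Multiplying by the conjugate of the tangent turns the tangential and normal components of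
  a vector into the real and imaginary parts of one complex number.\<close>

lemma inner_normal: "z \<bullet> (\<i> * v) = Im (z * cnj v)"
  by (simp add: inner_complex_def)

lemma unit_tangent_similarity:
  assumes "x differentiable (at s)"
  shows "unit_tangent (\<lambda>u. c * x u + d) s = sgn c * unit_tangent x s"
proof -
  have "((\<lambda>u. c * x u + d) has_vector_derivative c * vector_derivative x (at s)) (at s)"
    using assms by (auto intro!: derivative_eq_intros simp: vector_derivative_works[symmetric])
  then show ?thesis
    unfolding unit_tangent_def sgn_div_norm[symmetric]
    by (simp add: vector_derivative_at sgn_mult)
qed

lemma signed_curvature_similarity:
  assumes "open I" "s \<in> I" "\<And>u. u \<in> I \<Longrightarrow> x differentiable (at u)"
    and "unit_tangent x differentiable (at s)" "c \<noteq> 0"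
  shows "signed_curvature (\<lambda>u. c * x u + d) s = signed_curvature x s / norm c"
proof -
  let ?y = "\<lambda>u. c * x u + d"
  have "((\<lambda>u. sgn c * unit_tangent x u) has_vector_derivative
      sgn c * vector_derivative (unit_tangent x) (at s)) (at s)"
    using assms(4) by (auto intro!: derivative_eq_intros simp: vector_derivative_works[symmetric])
  then have "(unit_tangent ?y has_vector_derivative
      sgn c * vector_derivative (unit_tangent x) (at s)) (at s)"
    by (rule has_vector_derivative_transform_within_open[OF _ assms(1,2)])
      (use assms(3) in \<open>simp add: unit_tangent_similarity\<close>)
  then have t: "vector_derivative (unit_tangent ?y) (at s)
      = sgn c * vector_derivative (unit_tangent x) (at s)"
    by (rule vector_derivative_at)
  have "(?y has_vector_derivative c * vector_derivative x (at s)) (at s)"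
    using assms(2,3) by (auto intro!: derivative_eq_intros simp: vector_derivative_works[symmetric])
  then have y: "vector_derivative ?y (at s) = c * vector_derivative x (at s)"
    by (rule vector_derivative_at)
  have "sgn c * z * cnj (sgn c * w) = z * cnj w" for z w
  proof -
    have "sgn c * cnj (sgn c) = 1"
      using complex_norm_square[of "sgn c"] assms(5) by (simp add: norm_sgn)
    then show ?thesis by (simp add: algebra_simps)
  qed
  then have rot: "(sgn c * z) \<bullet> (\<i> * (sgn c * w)) = z \<bullet> (\<i> * w)" for z w
    unfolding inner_normal by presburger
  then show ?thesis
    unfolding signed_curvature_def unit_normal_def t y
      unit_tangent_similarity[OF assms(3)[OF assms(2)]] inner_scaleR_left rot norm_mult
    by (simp add: divide_inverse)
qed

section \<open>Plane curves with a unit frame\<close>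

text \<open>Tangent and curvature are parameters tied to the curve by the Frenet equation, so that all
  computations below are differentiations in the moving frame.\<close>

locale unit_speed_curve =
  fixes I :: "real set" and x \<tau> :: "real \<Rightarrow> complex" and k :: "real \<Rightarrow> real"
  assumes open_dom: "open I" and dom_nonempty: "I \<noteq> {}"
    and deriv_curve: "s \<in> I \<Longrightarrow> (x has_vector_derivative \<tau> s) (at s)"
    and deriv_tangent: "s \<in> I \<Longrightarrow> (\<tau> has_vector_derivative k s * (\<i> * \<tau> s)) (at s)"
    and norm_tangent: "s \<in> I \<Longrightarrow> norm (\<tau> s) = 1"
    and curvature_nonzero: "s \<in> I \<Longrightarrow> k s \<noteq> 0"
begin

lemma tangent_cnj: "s \<in> I \<Longrightarrow> \<tau> s * cnj (\<tau> s) = 1"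
  using complex_norm_square[of "\<tau> s"] norm_tangent by simp

text \<open>The vector field \<open>z \<mapsto> a z + b\<close> along the curve, in the moving frame: its real part is the
  tangential and its imaginary part the normal component.\<close>

definition frame_coord :: "complex \<Rightarrow> complex \<Rightarrow> real \<Rightarrow> complex" where
  "frame_coord a b s = (a * x s + b) * cnj (\<tau> s)"

text \<open>The coefficient \<open>a\<close> appears alone since the tangent has modulus one; the second term is the
  rotation of the frame.\<close>

lemma frame_coord_deriv:
  assumes "s \<in> I"
  shows "(frame_coord a b has_vector_derivative a - \<i> * k s * frame_coord a b s) (at s)"
proof -
  have "((\<lambda>u. a * x u + b) has_vector_derivative a * \<tau> s) (at s)"
    using has_vector_derivative_mult_right[OF deriv_curve[OF assms]]
    by (simp add: has_vector_derivative_add_const)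
  from has_vector_derivative_mult[OF this has_vector_derivative_cnj[OF deriv_tangent[OF assms]]]
  have "((\<lambda>u. (a * x u + b) * cnj (\<tau> u)) has_vector_derivative
      (a * x s + b) * cnj (k s * (\<i> * \<tau> s)) + a * \<tau> s * cnj (\<tau> s)) (at s)" .
  moreover have "a * \<tau> s * cnj (\<tau> s) = a"
    using tangent_cnj[OF assms] by (simp add: mult.assoc)
  ultimately show ?thesis
    unfolding frame_coord_def by (auto elim!: has_vector_derivative_eq_rhs simp: algebra_simps)
qed

lemma deriv_unique_on_dom:
  assumes "s \<in> I" "\<And>u. u \<in> I \<Longrightarrow> f u = g u"
    and "(f has_vector_derivative D) (at s)" "(g has_vector_derivative E) (at s)"
  shows "D = E"
  using has_vector_derivative_transform_within_open[OF assms(3) open_dom assms(1), of g] assms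
    vector_derivative_unique_at by blast

text \<open>If the normal component vanishes identically, so does its derivative, which by
  \<open>frame_coord_deriv\<close> is \<open>Im c\<close> minus \<open>k\<close> times the tangential component.\<close>

lemma tangential_coord:
  assumes "\<And>u. u \<in> I \<Longrightarrow> Im (frame_coord c d u) = 0" "s \<in> I"
  shows "frame_coord c d s = of_real (Im c / k s)"
proof -
  have "((\<lambda>u. Im (frame_coord c d u)) has_vector_derivative
      Im (c - \<i> * k s * frame_coord c d s)) (at s)"
    by (intro bounded_linear.has_vector_derivative[OF bounded_linear_Im] frame_coord_deriv assms)
  then have "Im (c - \<i> * k s * frame_coord c d s) = 0"
    using assms by - (rule deriv_unique_on_dom[of s _ "\<lambda>_. 0"], auto)
  then have "Re (frame_coord c d s) = Im c / k s"
    using curvature_nonzero[OF assms(2)] by (simp add: field_simps)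
  then show ?thesis using assms by (simp add: complex_eq_iff)
qed

lemma frame_coord_eq_0_iff: "s \<in> I \<Longrightarrow> frame_coord a b s = 0 \<longleftrightarrow> a * x s + b = 0"
  using norm_tangent[of s] by (auto simp: frame_coord_def)

text \<open>For real \<open>c\<close> the tangential component vanishes as well, so the whole field is zero along the
  curve, and its derivative \<open>c\<close> too. Geometrically, the curves tangent to a field of this kind that
  is nonzero with \<open>c\<close> real are straight lines.\<close>

lemma tangential_field_not_real:
  assumes tang: "\<And>u. u \<in> I \<Longrightarrow> Im (frame_coord c d u) = 0" and "Im c = 0"
  shows "c = 0 \<and> d = 0"
proof -
  obtain s where s: "s \<in> I" using dom_nonempty by blast
  have z: "frame_coord c d u = 0" if "u \<in> I" for u
    using tangential_coord[OF tang that] assms(2) by simp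
  have "c - \<i> * k s * frame_coord c d s = 0"
    using s z frame_coord_deriv[OF s, of c d]
    by - (rule deriv_unique_on_dom[of s "frame_coord c d" "\<lambda>_. 0"], auto)
  then have "c = 0" using z[OF s] by simp
  then show ?thesis using frame_coord_eq_0_iff[OF s, of c d] z[OF s] by simp
qed

text \<open>The tangent field \<open>c (z - p)\<close> is \<open>g = Im c / k\<close> times the unit tangent, and \<open>g' = Re c\<close>. Hence
  the flow equation forces the constant field \<open>\<beta> = b + a p\<close> to have normal component \<open>C g\<close> for some
  real \<open>C\<close>. One differentiation determines its tangential component, and a second one gives
  \<open>C (cnj c) c = 0\<close>.\<close>

lemma spiral_centre_is_fixed:
  assumes tang: "\<And>s. s \<in> I \<Longrightarrow> Im (frame_coord c (- c * p) s) = 0" and c: "c \<noteq> 0"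
    and flow: "\<And>s. s \<in> I \<Longrightarrow> Im (frame_coord a b s) = - 1 / k s"
  shows "b = - a * p"
proof -
  have Imc: "Im c \<noteq> 0" using tangential_field_not_real[of c "- c * p"] tang c by blast
  define g where "g = frame_coord c (- c * p)"
  define \<beta> where "\<beta> = b + a * p"
  define r where "r = frame_coord 0 \<beta>"
  \<comment> \<open>\<open>- 1 / k = - g / Im c\<close>, and \<open>a (z - p)\<close> is \<open>a / c\<close> times the tangent field, so its normal
    component is \<open>Im (a / c) g\<close>; \<open>C g\<close> is what remains for the constant field \<open>\<beta>\<close>.\<close>
  define C where "C = - 1 / Im c - Im (a / c)"
  have g: "g s = of_real (Im c / k s)" if "s \<in> I" for s
    unfolding g_def by (rule tangential_coord[OF tang that])
  have Im_r: "Im (r s) = C * Re (g s)" if "s \<in> I" for s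
  proof -
    have "frame_coord a b s = a / c * g s + r s"
      using c by (simp add: frame_coord_def g_def r_def \<beta>_def field_simps)
    moreover have "Im (a / c * g s) = Im (a / c) * Re (g s)"
      by (simp only: g[OF that] times_complex.sel Re_complex_of_real Im_complex_of_real
          mult_zero_right add_0)
    ultimately have "Im (r s) = - 1 / k s - Im (a / c) * Re (g s)"
      using flow[OF that] by simp
    also have "- 1 / k s = - 1 / Im c * Re (g s)" using g[OF that] Imc by simp
    finally show ?thesis by (simp add: C_def algebra_simps)
  qed
  have dg: "(g has_vector_derivative of_real (Re c)) (at s)" if "s \<in> I" for s
  proof -
    have "c - \<i> * k s * g s = of_real (Re c)"
      using g[OF that] curvature_nonzero[OF that] by (simp add: complex_eq_iff)
    then show ?thesis using frame_coord_deriv[OF that, of c "- c * p"] by (simp add: g_def)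
  qed
  have dr: "(r has_vector_derivative - \<i> * k s * r s) (at s)" if "s \<in> I" for s
    using frame_coord_deriv[OF that, of 0 \<beta>] by (simp add: r_def)
  have r: "r s = - (C / Im c) * cnj c * g s" if s: "s \<in> I" for s
  proof -
    have "((\<lambda>u. Im (r u)) has_vector_derivative Im (- \<i> * k s * r s)) (at s)"
      by (intro bounded_linear.has_vector_derivative[OF bounded_linear_Im] dr s)
    moreover have "((\<lambda>u. C * Re (g u)) has_vector_derivative C * Re (of_real (Re c))) (at s)"
      by (intro has_vector_derivative_mult_right
          bounded_linear.has_vector_derivative[OF bounded_linear_Re] dg s)
    ultimately have "- k s * Re (r s) = C * Re c"
      using deriv_unique_on_dom[OF s, of "\<lambda>u. Im (r u)" "\<lambda>u. C * Re (g u)"] Im_r by simp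
    then have "Re (r s) = - C * Re c / k s" using curvature_nonzero[OF s] by (simp add: field_simps)
    then show ?thesis
      using Im_r[OF s] g[OF s] Imc by (simp add: complex_eq_iff field_simps)
  qed
  obtain s where s: "s \<in> I" using dom_nonempty by blast
  have "((\<lambda>u. - (C / Im c) * cnj c * g u) has_vector_derivative
      - (C / Im c) * cnj c * of_real (Re c)) (at s)"
    by (intro has_vector_derivative_mult_right dg s)
  then have "- \<i> * k s * r s = - (C / Im c) * cnj c * of_real (Re c)"
    using deriv_unique_on_dom[OF s, of r "\<lambda>u. - (C / Im c) * cnj c * g u"] r dr[OF s] by blast
  then have "C * cnj c * (\<i> * Im c + Re c) = 0"
    using r[OF s] g[OF s] Imc curvature_nonzero[OF s] by (simp add: field_simps)
  moreover have "\<i> * Im c + Re c = c" by (simp add: complex_eq_iff)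
  ultimately have "C = 0" using c by simp
  then have "\<beta> = 0" using r[OF s] frame_coord_eq_0_iff[OF s, of 0 \<beta>] by (simp add: r_def)
  then show ?thesis by (simp add: \<beta>_def eq_neg_iff_add_eq_0)
qed

lemma frame_coord_diff: "frame_coord a b s - frame_coord a' b' s = frame_coord (a - a') (b - b') s"
  by (simp add: frame_coord_def algebra_simps)

text \<open>Either all fields agree and \<open>p\<close> is the zero of that one field, or two of them differ and \<open>p\<close> is
  the zero of their difference, which is tangent to the curve.\<close>

lemma common_centre:
  assumes flow: "\<And>s t. s \<in> I \<Longrightarrow> t \<in> J \<Longrightarrow> Im (frame_coord (a t) (b t) s) = - 1 / k s"
    and nz: "\<exists>t\<in>J. a t \<noteq> 0"
  shows "\<exists>p. \<forall>t\<in>J. b t = - a t * p"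
proof (cases "\<forall>t1\<in>J. \<forall>t2\<in>J. a t1 = a t2 \<and> b t1 = b t2")
  case True
  obtain t0 where t0: "t0 \<in> J" "a t0 \<noteq> 0" using nz by blast
  have "b t = - a t * (- b t0 / a t0)" if "t \<in> J" for t
  proof -
    have "a t = a t0" "b t = b t0" using True that t0(1) by blast+
    then show ?thesis using t0(2) by simp
  qed
  then show ?thesis by blast
next
  case False
  then obtain t1 t2 where t: "t1 \<in> J" "t2 \<in> J" "a t1 - a t2 \<noteq> 0 \<or> b t1 - b t2 \<noteq> 0" by auto
  define c d where "c = a t1 - a t2" and "d = b t1 - b t2"
  have tang: "Im (frame_coord c d s) = 0" if "s \<in> I" for s
    unfolding c_def d_def frame_coord_diff[symmetric] using flow t that by simp
  have c: "c \<noteq> 0" using tangential_field_not_real[of c d] tang t by (auto simp: c_def d_def)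
  have "b t = - a t * (- d / c)" if "t \<in> J" for t
    by (rule spiral_centre_is_fixed[OF _ c flow[OF _ that]]) (use tang c in simp)
  then show ?thesis by blast
qed

end

text \<open>The unit tangent \<open>\<tau>\<close> is orthogonal to its derivative, so the derivative is a real multiple of
  \<open>\<i> \<tau>\<close>, and that multiple is by definition the signed curvature.\<close>

lemma unit_speed_curve_of_arc_length:
  assumes "open I" "I \<noteq> {}" "smooth_on x I" "arc_length_on x I"
    and "\<forall>s\<in>I. signed_curvature x s \<noteq> 0"
  shows "unit_speed_curve I x (unit_tangent x) (signed_curvature x)"
proof
  fix s assume s: "s \<in> I"
  have eq: "unit_tangent x u = vector_derivative x (at u)" if "u \<in> I" for u
    using assms(4) that by (simp add: unit_tangent_def arc_length_on_def)
  show "(x has_vector_derivative unit_tangent x s) (at s)"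
    using smooth_on_has_vector_derivative[OF assms(3) s] eq[OF s] by simp
  have nrm: "norm (unit_tangent x u) = 1" if "u \<in> I" for u
    using assms(4) eq that by (simp add: arc_length_on_def)
  then show "norm (unit_tangent x s) = 1" using s .
  obtain D where "((\<lambda>u. vector_derivative x (at u)) has_vector_derivative D) (at s)"
    using smooth_on_has_second_vector_derivative[OF assms(3,1) s] by blast
  then have D: "(unit_tangent x has_vector_derivative D) (at s)"
    by (rule has_vector_derivative_transform_within_open[OF _ assms(1) s]) (simp add: eq)
  define \<tau> where "\<tau> = unit_tangent x s"
  have "((\<lambda>u. unit_tangent x u \<bullet> unit_tangent x u) has_vector_derivative D \<bullet> \<tau> + \<tau> \<bullet> D) (at s)"
    unfolding \<tau>_def
    by (rule has_vector_derivative_eq_rhs[OF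
          bounded_bilinear.has_vector_derivative[OF bounded_bilinear_inner D D]])
       (simp add: inner_commute)
  moreover have "((\<lambda>u. unit_tangent x u \<bullet> unit_tangent x u) has_vector_derivative 0) (at s)"
    by (rule has_vector_derivative_transform_within_open[OF has_vector_derivative_const assms(1) s,
          of 1]) (simp add: dot_square_norm nrm)
  ultimately have "D \<bullet> \<tau> + \<tau> \<bullet> D = 0" using vector_derivative_unique_at by blast
  then have orth: "D \<bullet> \<tau> = 0" by (simp add: inner_commute)
  have k: "signed_curvature x s = D \<bullet> (\<i> * \<tau>)"
    using assms(4) s D
    by (simp add: signed_curvature_def unit_normal_def arc_length_on_def vector_derivative_at \<tau>_def)
  have "\<tau> * cnj \<tau> = 1"
    using complex_norm_square[of \<tau>] nrm[OF s] by (simp add: \<tau>_def)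
  then have "D = D * cnj \<tau> * \<tau>" by (simp add: algebra_simps)
  also have "D * cnj \<tau> = \<i> * signed_curvature x s"
    using orth unfolding k inner_normal by (simp add: complex_eq_iff inner_complex_def)
  finally have "D = signed_curvature x s * (\<i> * \<tau>)" by (simp add: algebra_simps)
  with D show "(unit_tangent x has_vector_derivative
      signed_curvature x s * (\<i> * unit_tangent x s)) (at s)" by (simp add: \<tau>_def)
qed (use assms in auto)

section \<open>Families moving by similarities\<close>

text \<open>At time \<open>t\<close> the normal is rotated by \<open>w / \<bar>w\<bar>\<close> and the curvature divided by \<open>\<bar>w\<bar>\<close>; dividing the
  flow equation by \<open>\<bar>w\<bar>\<close> therefore leaves the field \<open>(w' z + T') / w\<close> on the left and \<open>- 1 / k\<close>, which
  is independent of \<open>t\<close>, on the right.\<close>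

lemma imcf_similarity:
  assumes frame: "unit_speed_curve I x (unit_tangent x) (signed_curvature x)"
    and imcf: "imcf_solution I J (\<lambda>s t. w t * x s + T t)"
    and w: "(w has_vector_derivative w') (at t)" "w t \<noteq> 0"
    and T: "(T has_vector_derivative T') (at t)"
    and s: "s \<in> I" and t: "t \<in> J"
  shows "Im (unit_speed_curve.frame_coord x (unit_tangent x) (w' / w t) (T' / w t) s)
    = - 1 / signed_curvature x s"
proof -
  interpret unit_speed_curve I x "unit_tangent x" "signed_curvature x" by (rule frame)
  have diff: "x differentiable (at u)" if "u \<in> I" for u
    using deriv_curve[OF that] by (rule differentiableI_vector)
  have "unit_tangent x differentiable (at s)"
    using deriv_tangent[OF s] by (rule differentiableI_vector)
  then have "signed_curvature (\<lambda>u. w t * x u + T t) s = signed_curvature x s / norm (w t)"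
    using signed_curvature_similarity[OF open_dom s diff _ w(2)] by simp
  moreover have "unit_normal (\<lambda>u. w t * x u + T t) s = \<i> * (sgn (w t) * unit_tangent x s)"
    by (simp add: unit_normal_def unit_tangent_similarity[OF diff[OF s]])
  moreover have "((\<lambda>t. w t * x s + T t) has_vector_derivative w' * x s + T') (at t)"
    by (auto intro!: derivative_eq_intros w T)
  ultimately have "Im ((w' * x s + T') * cnj (sgn (w t) * unit_tangent x s))
      = - norm (w t) / signed_curvature x s"
    using imcf s t unfolding imcf_solution_def inner_normal[symmetric]
    by (fastforce simp: vector_derivative_at)
  moreover have "(w' * x s + T') * cnj (sgn (w t) * unit_tangent x s)
      = of_real (norm (w t)) * frame_coord (w' / w t) (T' / w t) s"
  proof -
    have "cnj (sgn (w t)) = of_real (norm (w t)) / w t"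
      using complex_norm_square[of "w t"] w(2)
      by (simp add: sgn_div_norm scaleR_conv_of_real field_simps power2_eq_square)
    then show ?thesis
      unfolding frame_coord_def complex_cnj_mult by (simp add: algebra_simps add_divide_distrib)
  qed
  ultimately have "Im (of_real (norm (w t)) * frame_coord (w' / w t) (T' / w t) s)
      = - norm (w t) / signed_curvature x s"
    by (simp only:)
  then have "norm (w t) * Im (frame_coord (w' / w t) (T' / w t) s)
      = norm (w t) * (- 1 / signed_curvature x s)"
    by simp
  then show ?thesis using w(2) by (metis mult_left_cancel norm_eq_zero)
qed

lemma constant_on_open_interval:
  fixes f :: "real \<Rightarrow> 'b::real_normed_vector"
  assumes "open J" "is_interval J" "\<And>t. t \<in> J \<Longrightarrow> (f has_vector_derivative 0) (at t)"
    and "t \<in> J" "u \<in> J"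
  shows "f t = f u"
proof -
  have "\<And>t. t \<in> J \<Longrightarrow> (f has_vector_derivative 0) (at t within J)"
    using assms(3) has_vector_derivative_at_within by blast
  then show ?thesis
    using has_vector_derivative_zero_constant[of J f] assms(2,4,5)
    by (metis is_interval_convex)
qed

text \<open>By \<open>common_centre\<close>, \<open>T' = - p w'\<close>, so \<open>T + w p\<close> is constant, and its value at time zero is \<open>p\<close>.\<close>

lemma similarity_flow_has_centre:
  assumes frame: "unit_speed_curve I x (unit_tangent x) (signed_curvature x)"
    and J: "open J" "is_interval J" "0 \<in> J"
    and imcf: "imcf_solution I J (\<lambda>s t. w t * x s + T t)"
    and dw: "\<And>t. t \<in> J \<Longrightarrow> (w has_vector_derivative w' t) (at t)"
    and dT: "\<And>t. t \<in> J \<Longrightarrow> (T has_vector_derivative T' t) (at t)"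
    and w0: "\<And>t. t \<in> J \<Longrightarrow> w t \<noteq> 0"
    and init: "w 0 = 1" "T 0 = 0"
    and nonconst: "\<exists>t\<in>J. w' t \<noteq> 0"
  shows "\<exists>p. \<forall>t\<in>J. T t = p - w t * p"
proof -
  interpret unit_speed_curve I x "unit_tangent x" "signed_curvature x" by (rule frame)
  have "\<exists>p. \<forall>t\<in>J. T' t / w t = - (w' t / w t) * p"
  proof (rule common_centre)
    show "Im (frame_coord (w' t / w t) (T' t / w t) s) = - 1 / signed_curvature x s"
      if "s \<in> I" "t \<in> J" for s t
      using imcf_similarity[OF frame imcf dw w0 dT] that by blast
    show "\<exists>t\<in>J. w' t / w t \<noteq> 0" using nonconst w0 by simp
  qed
  then obtain p where p: "\<And>t. t \<in> J \<Longrightarrow> T' t / w t = - (w' t / w t) * p" by blast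
  have const: "((\<lambda>t. T t + w t * p) has_vector_derivative 0) (at t)" if "t \<in> J" for t
  proof -
    have "T' t + w' t * p = 0" using p[OF that] w0[OF that] by (simp add: field_simps)
    then show ?thesis
      using has_vector_derivative_add[OF dT[OF that]
          has_vector_derivative_mult_left[OF dw[OF that], of p]]
      by simp
  qed
  have "T t = p - w t * p" if "t \<in> J" for t
    using constant_on_open_interval[OF J(1,2) const that J(3)] init by (simp add: algebra_simps)
  then show ?thesis by blast
qed

theorem theorem1p3:
  fixes I J :: "real set" and x :: "real \<Rightarrow> complex"
    and S R :: "real \<Rightarrow> real" and T :: "real \<Rightarrow> complex"
  assumes "open I" "is_interval I" "I \<noteq> {}"
    and "open J" "is_interval J" "0 \<in> J"
    and "smooth_on x I" "arc_length_on x I"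
    and "\<forall>s\<in>I. signed_curvature x s \<noteq> 0"
    and "smooth_on S J" "smooth_on R J" "smooth_on T J"
    and "\<forall>t\<in>J. S t > 0"
    and "S 0 = 1" "R 0 = 0" "T 0 = 0"
    and "imcf_solution I J (\<lambda>s t. complex_of_real (S t) * exp (\<i> * complex_of_real (R t)) * x s + T t)"
    and "(\<exists>t\<in>J. R t \<noteq> 0) \<or> (\<exists>t\<in>J. S t \<noteq> 1)"
  shows "\<exists>(p :: complex) (S' :: real \<Rightarrow> real) (R' :: real \<Rightarrow> real).
           smooth_on S' J \<and> smooth_on R' J \<and> (\<forall>t\<in>J. S' t > 0) \<and> S' 0 = 1 \<and> R' 0 = 0 \<and>
           coincide_up_to_reparam I J
             (\<lambda>s t. complex_of_real (S t) * exp (\<i> * complex_of_real (R t)) * x s + T t)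
             (\<lambda>s t. p + complex_of_real (S' t) * exp (\<i> * complex_of_real (R' t)) * (x s - p))"
proof -
  define w where "w t = complex_of_real (S t) * exp (\<i> * complex_of_real (R t))" for t
  define S1 where "S1 t = vector_derivative S (at t)" for t
  define R1 where "R1 t = vector_derivative R (at t)" for t
  define T1 where "T1 t = vector_derivative T (at t)" for t
  define w1 where "w1 t = (S1 t + \<i> * S t * R1 t) * exp (\<i> * complex_of_real (R t))" for t
  have dS: "(S has_real_derivative S1 t) (at t)" if "t \<in> J" for t
    unfolding S1_def has_real_derivative_iff_has_vector_derivative
    using assms(10) that by (rule smooth_on_has_vector_derivative)
  have dR: "(R has_real_derivative R1 t) (at t)" if "t \<in> J" for t
    unfolding R1_def has_real_derivative_iff_has_vector_derivative
    using assms(11) that by (rule smooth_on_has_vector_derivative)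
  have dT: "(T has_vector_derivative T1 t) (at t)" if "t \<in> J" for t
    unfolding T1_def using assms(12) that by (rule smooth_on_has_vector_derivative)
  have dw: "(w has_vector_derivative w1 t) (at t)" if "t \<in> J" for t
  proof -
    have "((\<lambda>t. exp (\<i> * complex_of_real (R t))) has_vector_derivative
        (\<i> * of_real (R1 t)) * exp (\<i> * complex_of_real (R t))) (at t)"
      using field_vector_diff_chain_at[of "\<lambda>t. \<i> * complex_of_real (R t)" "\<i> * of_real (R1 t)" t exp]
        has_vector_derivative_mult_right[OF has_vector_derivative_of_real[OF dR[OF that]], of \<i>]
        DERIV_exp
      by (simp add: o_def)
    from has_vector_derivative_mult[OF has_vector_derivative_of_real[OF dS[OF that]] this]
    show ?thesis unfolding w_def[abs_def] w1_def by (simp add: algebra_simps)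
  qed
  have w0: "w t \<noteq> 0" if "t \<in> J" for t using assms(13) that by (force simp: w_def)
  \<comment> \<open>A constant \<open>w\<close> determines \<open>R\<close> only modulo \<open>2 \<pi>\<close>, so the constancy of \<open>R\<close> is read off from the
    real and imaginary parts of \<open>w' / e^(iR) = S' + i S R'\<close>.\<close>
  have "\<exists>t\<in>J. w1 t \<noteq> 0"
  proof (rule ccontr)
    assume "\<not> (\<exists>t\<in>J. w1 t \<noteq> 0)"
    then have "complex_of_real (S1 t) + \<i> * S t * R1 t = 0" if "t \<in> J" for t
      using that by (simp add: w1_def)
    then have "S1 t = 0 \<and> S t * R1 t = 0" if "t \<in> J" for t
      using that by (simp add: complex_eq_iff)
    then have "S1 t = 0" "R1 t = 0" if "t \<in> J" for t
      using assms(13) that by (metis less_irrefl mult_eq_0_iff)+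
    then have "S t = S 0" "R t = R 0" if "t \<in> J" for t
      using constant_on_open_interval[OF assms(4,5) _ that assms(6)] dS dR
      unfolding has_real_derivative_iff_has_vector_derivative by metis+
    then show False using assms(14,15,18) by auto
  qed
  then have "\<exists>p. \<forall>t\<in>J. T t = p - w t * p"
    using assms dw dT w0
    by (intro similarity_flow_has_centre[of I x J w T w1 T1] unit_speed_curve_of_arc_length)
      (auto simp: w_def)
  then obtain p where T: "\<And>t. t \<in> J \<Longrightarrow> T t = p - w t * p" by blast
  have "coincide_up_to_reparam I J (\<lambda>s t. w t * x s + T t) (\<lambda>s t. p + w t * (x s - p))"
    by (rule coincide_up_to_reparam_refl[OF assms(1,4,6)]) (simp add: T algebra_simps)
  note coincide = this[unfolded w_def]
  show ?thesis
    by (rule exI[of _ p], rule exI[of _ S], rule exI[of _ R], intro conjI;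
        fact assms coincide)
qed

end
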